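(* Let $f:\mathbb{N}\to\mathbb{N}$ be a non decreasing function. The following conditions are equivalent: (1) Every lattice $\mathcal{L}$ of regular subsets of $\mathbb{N}$ which is closed under decrement (i.e. $L\cap L'$, $L\cup L'$ and $L-1$ are in $\mathcal{L}$ whenever $L,L'\in\mathcal{L}$) is also closed under $f^{-1}$ (i.e. $L\in\mathcal{L}$ implies $f^{-1}(L)\in\mathcal{L}$). (2) The function $f$ satisfies the following properties: (i) $f(a)\geq a$ for all $a\in\mathbb{N}$; (ii) $f(a)-f(b)\equiv 0\pmod{(a-b)}$ for all $a,b\in\mathbb{N}$. Moreover, for every integer $n\geq 1$, the functions $x\mapsto nx$ and $x\mapsto x^n$ (for which $L\mapsto f^{-1}(L)$ is respectively the $n$-quotient $L\mapsto\{x\in\mathbb{N}\mid nx\in L\}$ and the $n$-root $L\mapsto\{x\in\mathbb{N}\mid x^n\in L\}$) are particular examples of such functions $f$.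
   Context: $\mathbb{N}=\{0,1,2,\ldots\}$. A function $f:\mathbb{N}\to\mathbb{N}$ is non decreasing if $a\leq b$ implies $f(a)\leq f(b)$. A lattice over a set $X$ is any non empty family of subsets of $X$ closed under (binary) union and intersection. For $L\subseteq\mathbb{N}$ and $i\in\mathbb{N}$, $L-i=\{x\in\mathbb{N}\mid x+i\in L\}$. A subset of $\mathbb{N}$ is regular if it is recognized by a finite automaton in unary notation; equivalently, if it is the union of a finite set with finitely many arithmetic progressions $a+r\mathbb{N}$ ($a,r\in\mathbb{N}$, $r\geq1$). $f^{-1}(L)=\{x\in\mathbb{N}\mid f(x)\in L\}$. Congruences are between integers. *)

theory Defs
  imports "HOL-Number_Theory.Cong"
begin

text \<open>
  Recognition by a finite deterministic automaton over a one-letter alphabet: the natural number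
  \<open>x\<close> is the word of length \<open>x\<close>, so reading it applies the transition function \<open>x\<close> times.  As the
  state set is finite, taking states to be natural numbers is no restriction.
\<close>

definition regular :: "nat set \<Rightarrow> bool" where
  "regular L \<longleftrightarrow>
     (\<exists>(Q :: nat set) (\<delta> :: nat \<Rightarrow> nat) q0 F.
        finite Q \<and> q0 \<in> Q \<and> (\<forall>q\<in>Q. \<delta> q \<in> Q) \<and> F \<subseteq> Q \<and>
        L = {x. (\<delta> ^^ x) q0 \<in> F})"

definition set_lattice_over :: "'a set \<Rightarrow> 'a set set \<Rightarrow> bool" where
  "set_lattice_over X \<L> \<longleftrightarrow>
     \<L> \<noteq> {} \<and> (\<forall>L\<in>\<L>. L \<subseteq> X) \<and>
     (\<forall>L\<in>\<L>. \<forall>L'\<in>\<L>. L \<union> L' \<in> \<L> \<and> L \<inter> L' \<in> \<L>)"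

definition set_minus :: "nat set \<Rightarrow> nat \<Rightarrow> nat set" where
  "set_minus L i = {x. x + i \<in> L}"

definition n_quotient :: "nat \<Rightarrow> nat set \<Rightarrow> nat set" where
  "n_quotient n L = {x. n * x \<in> L}"

definition n_root :: "nat \<Rightarrow> nat set \<Rightarrow> nat set" where
  "n_root n L = {x. x ^ n \<in> L}"

definition closed_lattices_preserved :: "(nat \<Rightarrow> nat) \<Rightarrow> bool" where
  "closed_lattices_preserved f \<longleftrightarrow>
     (\<forall>\<L>. set_lattice_over UNIV \<L> \<and> (\<forall>L\<in>\<L>. regular L) \<and> (\<forall>L\<in>\<L>. set_minus L 1 \<in> \<L>)
        \<longrightarrow> (\<forall>L\<in>\<L>. f -` L \<in> \<L>))"

definition extensive_congruence_preserving :: "(nat \<Rightarrow> nat) \<Rightarrow> bool" where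
  "extensive_congruence_preserving f \<longleftrightarrow>
     (\<forall>a. f a \<ge> a) \<and>
     (\<forall>a b. [int (f a) - int (f b) = 0] (mod (int a - int b)))"

text \<open>The usual description of regular sets by arithmetic progressions.\<close>

lemma regular_imp_progressions:
  assumes "regular L"
  shows "\<exists>A P. finite A \<and> finite P \<and> (\<forall>(a, r)\<in>P. r \<ge> 1) \<and>
           L = A \<union> (\<Union>(a, r)\<in>P. {a + r * k | k. True})"
proof -
  obtain Q :: "nat set" and \<delta> q0 F where Q: "finite Q" "q0 \<in> Q" "\<forall>q\<in>Q. \<delta> q \<in> Q"
    and L: "L = {x. (\<delta> ^^ x) q0 \<in> F}"
    using assms unfolding regular_def by blast
  define s where "s x = (\<delta> ^^ x) q0" for x
  have s_Q: "s x \<in> Q" for x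
    by (induction x) (use Q in \<open>auto simp: s_def\<close>)
  have "\<not> inj s"
    using s_Q Q(1) by (metis finite_subset image_subsetI infinite_UNIV_nat finite_imageD)
  then obtain i j where ij: "i < j" "s i = s j"
    unfolding inj_def by (metis linorder_neqE_nat)
  have s_add: "s (x + y) = (\<delta> ^^ x) (s y)" for x y
    by (simp add: s_def funpow_add)
  define r where "r = j - i"
  have r: "r \<ge> 1" "i + r = j" using ij by (auto simp: r_def)
  have per: "s (x + r) = s x" if "x \<ge> i" for x
  proof -
    have "x + r = (x - i) + j" using that r by linarith
    then have "s (x + r) = s ((x - i) + j)" by (rule arg_cong)
    also have "\<dots> = s ((x - i) + i)" using ij by (simp only: s_add)
    finally show ?thesis using that by simp
  qed
  have perk: "s (x + r * k) = s x" if "x \<ge> i" for x k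
  proof (induction k)
    case (Suc k)
    then show ?case using per[of "x + r * k"] that by (simp add: algebra_simps)
  qed simp
  have mem: "x \<in> L \<longleftrightarrow> s x \<in> F" for x by (simp add: L s_def)
  define A where "A = L \<inter> {..<i}"
  define P where "P = (\<lambda>a. (a, r)) ` (L \<inter> {i..<j})"
  have "L = A \<union> (\<Union>(a, r)\<in>P. {a + r * k | k. True})"
  proof (intro set_eqI iffI)
    fix x assume x: "x \<in> L"
    show "x \<in> A \<union> (\<Union>(a, r)\<in>P. {a + r * k | k. True})"
    proof (cases "x < i")
      case False
      define a where "a = i + (x - i) mod r"
      have xa: "x = a + r * ((x - i) div r)"
        using False by (simp add: a_def add.assoc)
      have a: "i \<le> a" "a < j" using r by (auto simp: a_def intro: less_le_trans)
      have "a \<in> L" using x perk[OF a(1), of "(x - i) div r"] xa mem by metis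
      then have "(a, r) \<in> P" using a by (auto simp: P_def)
      then show ?thesis using xa by blast
    qed (use x in \<open>simp add: A_def\<close>)
  next
    fix x assume "x \<in> A \<union> (\<Union>(a, r)\<in>P. {a + r * k | k. True})"
    then show "x \<in> L" using perk by (auto simp: A_def P_def mem)
  qed
  moreover have "finite A" "finite P" "\<forall>(a, r)\<in>P. r \<ge> 1"
    using r by (auto simp: A_def P_def)
  ultimately show ?thesis by blast
qed

lemma progressions_imp_regular:
  assumes "finite A" "finite P" and P: "\<forall>(a, r)\<in>P. r \<ge> 1"
    and L: "L = A \<union> (\<Union>(a, r)\<in>P. {a + r * k | k. True})"
  shows "regular L"
proof -
  define R where "R = (\<Prod>p\<in>P. snd p)"
  have R: "R \<ge> 1" using P by (auto simp: R_def Suc_le_eq intro!: prod_pos)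
  have dvdR: "r dvd R" if "(a, r) \<in> P" for a r
    unfolding R_def using dvd_prodI[OF assms(2) that, of snd] by simp
  have "finite (A \<union> fst ` P)" using assms by simp
  then obtain N where N: "\<forall>x\<in>A \<union> fst ` P. x < N"
    using finite_nat_set_iff_bounded by blast
  have per: "x + R \<in> L \<longleftrightarrow> x \<in> L" if x: "x \<ge> N" for x
  proof -
    have mem: "y \<in> L \<longleftrightarrow> (\<exists>(a, r)\<in>P. r dvd (y - a))" if "y \<ge> N" for y
    proof -
      have "y \<notin> A" using N that by (meson UnI1 not_le)
      then have L_iff: "y \<in> L \<longleftrightarrow> (\<exists>(a, r)\<in>P. \<exists>k. y = a + r * k)"
        unfolding L by auto
      have "(\<exists>k. y = a + r * k) \<longleftrightarrow> r dvd (y - a)" if "(a, r) \<in> P" for a r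
      proof -
        have "a < N" using N that by force
        then have "a \<le> y" using \<open>y \<ge> N\<close> by simp
        then show ?thesis unfolding dvd_def by (metis add_diff_cancel_left' le_add_diff_inverse)
      qed
      then show ?thesis unfolding L_iff by (intro bex_cong) auto
    qed
    have "r dvd (x + R - a) \<longleftrightarrow> r dvd (x - a)" if "(a, r) \<in> P" for a r
    proof -
      have "a < N" using N that by force
      then have "x + R - a = (x - a) + R" using x by simp
      then show ?thesis using dvdR[OF that] by (simp add: dvd_add_left_iff)
    qed
    then have "(\<exists>(a, r)\<in>P. r dvd (x + R - a)) \<longleftrightarrow> (\<exists>(a, r)\<in>P. r dvd (x - a))"
      by (intro bex_cong) auto
    then show ?thesis using mem[of x] mem[of "x + R"] x by simp
  qed
  have perk: "x + R * k \<in> L \<longleftrightarrow> x \<in> L" if x: "x \<ge> N" for x k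
  proof (induction k)
    case (Suc k)
    then show ?case using per[of "x + R * k"] x by (simp add: algebra_simps)
  qed simp
  define s where "s x = (if x < N then x else N + (x - N) mod R)" for x
  define \<delta> where "\<delta> q = s (Suc q)" for q
  have s_step: "s (Suc (s x)) = s (Suc x)" for x
    using R by (auto simp: s_def Suc_diff_le mod_Suc_eq)
  have run: "(\<delta> ^^ x) (s 0) = s x" for x
    by (induction x) (auto simp: \<delta>_def s_step)
  have s_bound: "s x < N + R" for x
    using R by (auto simp: s_def)
  have s_mem: "s x \<in> L \<longleftrightarrow> x \<in> L" for x
  proof (cases "x < N")
    case False
    then have "s x + R * ((x - N) div R) = x" "s x \<ge> N" by (simp_all add: s_def)
    then show ?thesis using perk[of "s x" "(x - N) div R"] by simp
  qed (simp add: s_def)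
  have "L = {x. (\<delta> ^^ x) (s 0) \<in> L \<inter> {..<N + R}}"
    by (auto simp: run s_mem s_bound)
  moreover have "finite {..<N + R}" "s 0 \<in> {..<N + R}" "\<forall>q\<in>{..<N + R}. \<delta> q \<in> {..<N + R}"
    "L \<inter> {..<N + R} \<subseteq> {..<N + R}"
    by (auto simp: \<delta>_def s_bound)
  ultimately show ?thesis unfolding regular_def by metis
qed

theorem regular_iff_progressions:
  "regular L \<longleftrightarrow>
     (\<exists>A P. finite A \<and> finite P \<and> (\<forall>(a, r)\<in>P. r \<ge> 1) \<and>
        L = A \<union> (\<Union>(a, r)\<in>P. {a + r * k | k. True}))"
  by (rule iffI, erule regular_imp_progressions, elim exE conjE, rule progressions_imp_regular)

end

theory Submission
  imports Defs
begin

text \<open>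
  For a regular \<open>L\<close> the family of all \<open>L - i\<close> is finite, so the atom of \<open>a\<close>, the intersection of
  all \<open>L - i\<close> containing \<open>a\<close>, belongs to every lattice that contains \<open>L\<close> and is closed under
  decrement. If \<open>x\<close> is in the atom of \<open>a\<close>, then membership in \<open>L\<close> passes from \<open>a + j\<close> to \<open>x + j\<close>
  for all natural \<open>j\<close>. As \<open>f x\<close> is reached from \<open>f a\<close> by steps of length \<open>x - a\<close>, all of them of this
  kind because \<open>f\<close> is extensive, \<open>f a \<in> L\<close> implies \<open>f x \<in> L\<close>; hence \<open>f -` L\<close> is a finite union
  of atoms. When that union is empty, so is the intersection of all \<open>L - i\<close>. Conversely, the lattice of subsets of \<open>{..f a}\<close> forces \<open>a \<le> f a\<close>, and the lattice of
  \<open>d\<close>-periodic sets forces \<open>f\<close> to preserve congruence modulo \<open>d\<close>.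
\<close>

lemma regular_finite: "finite L \<Longrightarrow> regular L"
  by (rule progressions_imp_regular[of L "{}"]) auto

text \<open>The automaton is the cycle of residues modulo \<open>d\<close>, whose accepting states
  are the residues lying in \<open>L\<close>.\<close>

lemma regular_periodic:
  assumes "d > 0" and per: "\<And>x. x + d \<in> L \<longleftrightarrow> x \<in> L"
  shows "regular L"
proof -
  define \<delta> where "\<delta> q = Suc q mod d" for q
  have run: "(\<delta> ^^ x) 0 = x mod d" for x
    by (induction x) (auto simp: \<delta>_def mod_Suc_eq)
  have "x + k * d \<in> L \<longleftrightarrow> x \<in> L" for x k
  proof (induction k)
    case (Suc k)
    then show ?case using per[of "x + k * d"] by (simp add: algebra_simps)
  qed simp
  then have "x mod d \<in> L \<longleftrightarrow> x \<in> L" for x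
    by (metis mod_div_mult_eq)
  then have "L = {x. (\<delta> ^^ x) 0 \<in> L \<inter> {..<d}}"
    using assms(1) by (auto simp: run)
  moreover have "finite {..<d}" "0 \<in> {..<d}" "\<forall>q\<in>{..<d}. \<delta> q \<in> {..<d}" "L \<inter> {..<d} \<subseteq> {..<d}"
    using assms(1) by (auto simp: \<delta>_def)
  ultimately show ?thesis unfolding regular_def by metis
qed

text \<open>Starting the automaton of \<open>L\<close> in the state reached after \<open>i\<close>
  steps recognizes \<open>set_minus L i\<close>, so there are at most as many such sets as
  states.\<close>

lemma finite_range_set_minus:
  assumes "regular L"
  shows "finite (range (set_minus L))"
proof -
  obtain Q :: "nat set" and \<delta> q0 F where Q: "finite Q" "q0 \<in> Q" "\<forall>q\<in>Q. \<delta> q \<in> Q"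
    and L: "L = {x. (\<delta> ^^ x) q0 \<in> F}"
    using assms unfolding regular_def by blast
  have "(\<delta> ^^ i) q0 \<in> Q" for i
    by (induction i) (use Q in auto)
  then have "range (set_minus L) \<subseteq> (\<lambda>q. {x. (\<delta> ^^ x) q \<in> F}) ` Q"
    by (auto simp: set_minus_def L funpow_add)
  then show ?thesis using Q(1) finite_surj by blast
qed

text \<open>A lattice need not contain \<open>{}\<close> or \<open>UNIV\<close>, so only nonempty
  finite families are combined, here and for intersections.\<close>

lemma set_lattice_over_Union:
  assumes "set_lattice_over X \<L>" "finite \<A>" "\<A> \<noteq> {}" "\<A> \<subseteq> \<L>"
  shows "\<Union>\<A> \<in> \<L>"
  using assms(2-4)
  by (induction rule: finite_ne_induct) (use assms(1) in \<open>auto simp: set_lattice_over_def\<close>)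

lemma set_lattice_over_Inter:
  assumes "set_lattice_over X \<L>" "finite \<A>" "\<A> \<noteq> {}" "\<A> \<subseteq> \<L>"
  shows "\<Inter>\<A> \<in> \<L>"
  using assms(2-4)
  by (induction rule: finite_ne_induct) (use assms(1) in \<open>auto simp: set_lattice_over_def\<close>)

lemma set_minus_mem:
  assumes "\<forall>L\<in>\<L>. set_minus L 1 \<in> \<L>" "L \<in> \<L>"
  shows "set_minus L i \<in> \<L>"
proof (induction i)
  case (Suc i)
  have "set_minus L (Suc i) = set_minus (set_minus L i) 1"
    by (simp add: set_minus_def)
  then show ?case using Suc assms(1) by simp
qed (use assms in \<open>simp add: set_minus_def\<close>)

lemma extensive_congruence_preserving_mem:
  assumes "mono f" and ecp: "extensive_congruence_preserving f"
    and "f a \<in> L" and shift: "\<And>j. a + j \<in> L \<Longrightarrow> x + j \<in> L"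
  shows "f x \<in> L"
proof (cases "a \<le> x")
  case True
  define d where "d = x - a"
  have x: "x = a + d" using True by (simp add: d_def)
  have "int d dvd int (f x) - int (f a)"
    using ecp x unfolding extensive_congruence_preserving_def cong_0_iff
    by (metis add_diff_cancel_left' of_nat_add)
  \<comment> \<open>Monotonicity makes the difference nonnegative, so the integer divisibility
    carries over to the naturals.\<close>
  moreover have "f a \<le> f x" using \<open>mono f\<close> True by (rule monoD)
  ultimately have "d dvd f x - f a"
    by (metis of_nat_diff int_dvd_int_iff)
  then obtain k where k: "f x = f a + d * k"
    using \<open>f a \<le> f x\<close> by (metis dvdE le_add_diff_inverse)
  have "a \<le> f a" using ecp by (simp add: extensive_congruence_preserving_def)
  \<comment> \<open>Climb from \<open>f a\<close> in steps of \<open>d\<close>: with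
    \<open>j = f a - a + d * k\<close>, an exact subtraction as \<open>a \<le> f a\<close>, the
    shift leads from \<open>a + j = f a + d * k\<close> to
    \<open>x + j = f a + d * Suc k\<close>.\<close>
  have "f a + d * k \<in> L" for k
  proof (induction k)
    case (Suc k)
    then show ?case
      using shift[of "f a - a + d * k"] \<open>a \<le> f a\<close> by (simp add: x algebra_simps)
  qed (use \<open>f a \<in> L\<close> in simp)
  then show ?thesis by (simp add: k)
next
  case False
  define d where "d = a - x"
  have a: "a = x + d" using False by (simp add: d_def)
  have "int d dvd int (f a) - int (f x)"
    using ecp a unfolding extensive_congruence_preserving_def cong_0_iff
    by (metis add_diff_cancel_left' of_nat_add)
  moreover have "f x \<le> f a" using \<open>mono f\<close> False by (simp add: monoD)
  ultimately have "d dvd f a - f x"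
    by (metis of_nat_diff int_dvd_int_iff)
  then obtain k where k: "f a = f x + d * k"
    using \<open>f x \<le> f a\<close> by (metis dvdE le_add_diff_inverse)
  have "x \<le> f x" using ecp by (simp add: extensive_congruence_preserving_def)
  \<comment> \<open>Now \<open>x < a\<close>, so each shift lowers a member of \<open>L\<close> by
    \<open>d\<close>; the induction descends to \<open>f x\<close>.\<close>
  have "f x + d * k \<in> L \<Longrightarrow> f x \<in> L" for k
  proof (induction k)
    case (Suc k)
    then show ?case
      using shift[of "f x - x + d * k"] \<open>x \<le> f x\<close> by (simp add: a algebra_simps)
  qed simp
  then show ?thesis using \<open>f a \<in> L\<close> k by metis
qed

lemma extensive_congruence_preserving_imp_closed_lattices_preserved:
  assumes "mono f" and ecp: "extensive_congruence_preserving f"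
  shows "closed_lattices_preserved f"
  unfolding closed_lattices_preserved_def
proof (intro allI impI ballI)
  fix \<L> :: "nat set set" and L
  assume "set_lattice_over UNIV \<L> \<and> (\<forall>L\<in>\<L>. regular L) \<and> (\<forall>L\<in>\<L>. set_minus L 1 \<in> \<L>)"
    and L: "L \<in> \<L>"
  then have lat: "set_lattice_over UNIV \<L>" and "regular L"
    and dec: "range (set_minus L) \<subseteq> \<L>"
    using set_minus_mem by auto
  have fin: "finite (range (set_minus L))"
    using \<open>regular L\<close> by (rule finite_range_set_minus)
  have ext: "x \<le> f x" for x
    using ecp by (simp add: extensive_congruence_preserving_def)
  define M where "M a = {S \<in> range (set_minus L). a \<in> S}" for a
  have M_sub: "M a \<subseteq> range (set_minus L)" for a by (auto simp: M_def)
  show "f -` L \<in> \<L>"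
  proof (cases "f -` L = {}")
    case True
    \<comment> \<open>An empty union is not a lattice operation, so \<open>{}\<close> is obtained as
      an intersection: each \<open>x\<close> is missing from the decrement of \<open>L\<close> by
      \<open>f x - x\<close>, because \<open>f x\<close> is not in \<open>L\<close>.\<close>
    have "\<Inter>(range (set_minus L)) = {}"
    proof (rule equals0I)
      fix x assume "x \<in> \<Inter>(range (set_minus L))"
      then have "x + (f x - x) \<in> L" by (auto simp: set_minus_def)
      then show False using True ext[of x] by auto
    qed
    then show ?thesis
      using set_lattice_over_Inter[OF lat fin _ dec] True by simp
  next
    case False
    \<comment> \<open>If \<open>M a\<close> were empty, its intersection would be
      \<open>UNIV\<close>, which may lie outside the lattice.\<close>
    have ne: "M a \<noteq> {}" if "f a \<in> L" for a
    proof -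
      have "a \<in> set_minus L (f a - a)" using that ext[of a] by (simp add: set_minus_def)
      then show ?thesis by (auto simp: M_def)
    qed
    have atom: "\<Inter>(M a) \<subseteq> f -` L" if "f a \<in> L" for a
    proof
      fix x assume "x \<in> \<Inter>(M a)"
      then have "x + j \<in> L" if "a + j \<in> L" for j
        using that by (auto simp: M_def set_minus_def)
      then show "x \<in> f -` L"
        using extensive_congruence_preserving_mem[OF assms \<open>f a \<in> L\<close>] by simp
    qed
    have "a \<in> \<Inter>(M a)" for a by (auto simp: M_def)
    then have "f -` L = \<Union>((\<lambda>a. \<Inter>(M a)) ` (f -` L))"
      using atom by fastforce
    moreover have "(\<lambda>a. \<Inter>(M a)) ` (f -` L) \<subseteq> \<L>"
      using set_lattice_over_Inter[OF lat finite_subset[OF M_sub fin] ne] M_sub dec by blast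
    \<comment> \<open>The preimage may be infinite, but each atom is determined by a subset of the
      finite set of decrements.\<close>
    moreover have "finite ((\<lambda>a. \<Inter>(M a)) ` (f -` L))"
    proof (rule finite_subset)
      show "(\<lambda>a. \<Inter>(M a)) ` (f -` L) \<subseteq> Inter ` Pow (range (set_minus L))"
        using M_sub by blast
      show "finite (Inter ` Pow (range (set_minus L)))" using fin by simp
    qed
    ultimately show ?thesis
      using set_lattice_over_Union[OF lat] False by (metis image_is_empty)
  qed
qed

lemma closed_lattices_preserved_imp_extensive:
  assumes "closed_lattices_preserved f"
  shows "a \<le> f a"
proof -
  let ?\<L> = "Pow {..f a}"
  have "set_lattice_over UNIV ?\<L>" by (auto simp: set_lattice_over_def)
  moreover have "\<forall>L\<in>?\<L>. regular L" using finite_subset by (blast intro: regular_finite)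
  moreover have "\<forall>L\<in>?\<L>. set_minus L 1 \<in> ?\<L>" by (force simp: set_minus_def)
  \<comment> \<open>This preimage contains \<open>a\<close>, so its inclusion in
    \<open>{..f a}\<close> bounds \<open>a\<close> by \<open>f a\<close>.\<close>
  ultimately have "f -` {f a} \<in> ?\<L>"
    using assms unfolding closed_lattices_preserved_def by blast
  then show ?thesis by auto
qed

lemma closed_lattices_preserved_imp_cong:
  assumes "closed_lattices_preserved f" "d > 0"
  shows "[f (a + d) = f a] (mod d)"
proof -
  let ?\<L> = "{L. \<forall>x. x + d \<in> L \<longleftrightarrow> x \<in> L}"
  have "UNIV \<in> ?\<L>" by simp
  then have "?\<L> \<noteq> {}" by blast
  then have "set_lattice_over UNIV ?\<L>" by (simp add: set_lattice_over_def)
  moreover have "\<forall>L\<in>?\<L>. regular L" using regular_periodic[OF assms(2)] by simp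
  moreover have "\<forall>L\<in>?\<L>. set_minus L 1 \<in> ?\<L>"
  proof (intro ballI CollectI allI)
    fix L x assume "L \<in> ?\<L>"
    then have "Suc x + d \<in> L \<longleftrightarrow> Suc x \<in> L" by blast
    then show "x + d \<in> set_minus L 1 \<longleftrightarrow> x \<in> set_minus L 1" by (simp add: set_minus_def)
  qed
  \<comment> \<open>The residue class of \<open>f a\<close> is the test set: its preimage contains
    \<open>a\<close> and is \<open>d\<close>-periodic, hence contains \<open>a + d\<close>.\<close>
  moreover have "{y. [y = f a] (mod d)} \<in> ?\<L>" by (simp add: cong_def)
  ultimately have "f -` {y. [y = f a] (mod d)} \<in> ?\<L>"
    using assms(1)[unfolded closed_lattices_preserved_def, rule_format, of ?\<L>] by blast
  then have "a + d \<in> f -` {y. [y = f a] (mod d)} \<longleftrightarrow> a \<in> f -` {y. [y = f a] (mod d)}" by blast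
  then show ?thesis by simp
qed

lemma closed_lattices_preserved_imp_extensive_congruence_preserving:
  assumes "closed_lattices_preserved f"
  shows "extensive_congruence_preserving f"
  unfolding extensive_congruence_preserving_def cong_0_iff
proof (intro conjI allI)
  show "a \<le> f a" for a using assms by (rule closed_lattices_preserved_imp_extensive)
  have less_dvd: "int b - int a dvd int (f b) - int (f a)" if "a < b" for a b
  proof -
    have "[f b = f a] (mod (b - a))"
      using closed_lattices_preserved_imp_cong[OF assms, of "b - a" a] that by simp
    then have "[int (f b) = int (f a)] (mod int (b - a))" by (simp only: cong_int_iff)
    then show ?thesis using that by (simp add: cong_iff_dvd_diff of_nat_diff)
  qed
  show "int a - int b dvd int (f a) - int (f b)" for a b
  proof (cases a b rule: linorder_cases)
    case less
    then have "- (int b - int a) dvd - (int (f b) - int (f a))"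
      using less_dvd by (simp only: minus_dvd_iff dvd_minus_iff)
    then show ?thesis by simp
  qed (use less_dvd in auto)
qed

lemma extensive_congruence_preserving_times:
  assumes "n \<ge> 1"
  shows "extensive_congruence_preserving (\<lambda>x. n * x)"
  using assms
  by (auto simp: extensive_congruence_preserving_def cong_0_iff right_diff_distrib[symmetric])

lemma extensive_congruence_preserving_power:
  assumes "n \<ge> 1"
  shows "extensive_congruence_preserving (\<lambda>x. x ^ n)"
  unfolding extensive_congruence_preserving_def
proof (intro conjI allI)
  show "a \<le> a ^ n" for a :: nat
    using assms by (cases "a = 0") (auto intro: self_le_power)
  show "[int (a ^ n) - int (b ^ n) = 0] (mod (int a - int b))" for a b
    \<comment> \<open>Raise the trivial congruence of \<open>a\<close> and \<open>b\<close> modulo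
      \<open>a - b\<close> to the power \<open>n\<close>.\<close>
    using cong_pow[of "int a" "int b" "int a - int b" n]
    by (simp add: cong_0_iff cong_iff_dvd_diff)
qed

theorem theorem1p1:
  shows "(\<forall>f :: nat \<Rightarrow> nat. mono f \<longrightarrow>
            (closed_lattices_preserved f \<longleftrightarrow> extensive_congruence_preserving f)) \<and>
         (\<forall>n \<ge> (1::nat).
            (mono (\<lambda>x::nat. n * x) \<and>
             closed_lattices_preserved (\<lambda>x. n * x) \<and>
             extensive_congruence_preserving (\<lambda>x. n * x) \<and>
             (\<forall>L. (\<lambda>x. n * x) -` L = n_quotient n L)) \<and>
            (mono (\<lambda>x::nat. x ^ n) \<and>
             closed_lattices_preserved (\<lambda>x. x ^ n) \<and>
             extensive_congruence_preserving (\<lambda>x. x ^ n) \<and>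
             (\<forall>L. (\<lambda>x. x ^ n) -` L = n_root n L)))"
proof (intro conjI allI impI)
  fix f :: "nat \<Rightarrow> nat"
  assume "mono f"
  then show "closed_lattices_preserved f \<longleftrightarrow> extensive_congruence_preserving f"
    using closed_lattices_preserved_imp_extensive_congruence_preserving
      extensive_congruence_preserving_imp_closed_lattices_preserved by blast
next
  fix n :: nat
  assume n: "n \<ge> 1"
  show mono_times: "mono (\<lambda>x::nat. n * x)" by (simp add: mono_def)
  show ecp_times: "extensive_congruence_preserving (\<lambda>x. n * x)"
    using n by (rule extensive_congruence_preserving_times)
  show "closed_lattices_preserved (\<lambda>x. n * x)"
    using mono_times ecp_times
    by (rule extensive_congruence_preserving_imp_closed_lattices_preserved)
  show "(\<lambda>x. n * x) -` L = n_quotient n L" for L by (auto simp: n_quotient_def)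
  show mono_power: "mono (\<lambda>x::nat. x ^ n)" by (simp add: mono_def power_mono)
  show ecp_power: "extensive_congruence_preserving (\<lambda>x. x ^ n)"
    using n by (rule extensive_congruence_preserving_power)
  show "closed_lattices_preserved (\<lambda>x. x ^ n)"
    using mono_power ecp_power
    by (rule extensive_congruence_preserving_imp_closed_lattices_preserved)
  show "(\<lambda>x. x ^ n) -` L = n_root n L" for L by (auto simp: n_root_def)
qed

end
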